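(* Let $m\ge 1$ and $n\ge 2$ be integers, let $M=\{1,\dots,m\}$ be a set of items and $N=\{1,\dots,n\}$ a set of agents with linear valuations given by numbers $v_{\ell i}\ge 0$ ($\ell\in M$, $i\in N$). For $y=(y_{\ell i})\in\mathbb{R}^{mn}$ define $$\bar h(y)=\max_{\substack{i,j\in N,\ i\neq j\\ k\in M}}\Big(y_{kj}+\sum_{\ell\in M,\ \ell\neq k}\max\Big\{y_{\ell i}-v_{\ell i},\ y_{\ell j}+v_{\ell i},\ \max_{r\in N\setminus\{i,j\}}y_{\ell r}\Big\}\Big),\qquad h(y)=\sum_{\ell\in M}\max_{r\in N}y_{\ell r}.$$ Then $\bar h$ and $h$ are continuous convex functions on $\mathbb{R}^{mn}$, and $\inf_{y\in\mathbb{R}^{mn}}\big(\bar h(y)-h(y)\big)$ equals the infimum of the piecewise linear concave function $w-h(y)$ over all $y\in\mathbb{R}^{mn}$, $w\in\mathbb{R}$ and $z=(z_{\ell ij})_{\ell\in M,\ i,j\in N,\ i\neq j}$ with real entries satisfying the linear constraints $$\begin{aligned} & y_{kj}+\sum_{\ell\neq k}z_{\ell ij}-w\le 0 && \forall k\in M,\ i\neq j,\\ & y_{\ell i}-z_{\ell ij}\le v_{\ell i} && \forall \ell\in M,\ i\neq j,\\ & y_{\ell j}-z_{\ell ij}\le -v_{\ell i} && \forall \ell\in M,\ i\neq j,\\ & y_{\ell r}-z_{\ell ij}\le 0 && \forall \ell\in M,\ i\neq j,\ r\in N\setminus\{i,j\}. \end{aligned}$$ An EFX allocation exists if and only if this common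 infimum is nonpositive.
   Context: Linear valuations: agent $i$ values a set $S\subseteq M$ of items at $v_i(S)=\sum_{k\in S}v_{ki}$, where $v_{ki}\ge 0$ is the value agent $i$ assigns to item $k$. An EFX allocation (envy-free up to any good) is a partition $X=(X_1,\dots,X_n)$ of $M$ (pairwise disjoint, possibly empty sets with union $M$) such that $v_i(X_i)\ge v_i(X_j\setminus\{k\})$ for all $i,j\in N$ and all $k\in X_j$. When $n=2$, the inner term $\max_{r\in N\setminus\{i,j\}}y_{\ell r}$ is a maximum over the empty set and is omitted (i.e. taken to be $-\infty$). *)

theory Defs
  imports "HOL-Analysis.Analysis"
begin

text \<open>Items are the elements of the finite type \<open>'m\<close>, agents those of the finite type \<open>'n\<close>;
  \<open>v k i\<close> is the value of item \<open>k\<close> for agent \<open>i\<close>, and \<open>y $ k $ i\<close> is the entry \<open>y\<^sub>k\<^sub>i\<close> of a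
  point of \<open>m * n\<close>-dimensional Euclidean space.\<close>

definition bundle_value :: "('m \<Rightarrow> 'n \<Rightarrow> real) \<Rightarrow> 'n \<Rightarrow> 'm set \<Rightarrow> real" where
  "bundle_value v i S = (\<Sum>k\<in>S. v k i)"

definition allocation :: "('n \<Rightarrow> 'm set) \<Rightarrow> bool" where
  "allocation X \<longleftrightarrow> disjoint_family X \<and> (\<Union>i. X i) = UNIV"

definition EFX_allocation :: "('m \<Rightarrow> 'n \<Rightarrow> real) \<Rightarrow> ('n \<Rightarrow> 'm set) \<Rightarrow> bool" where
  "EFX_allocation v X \<longleftrightarrow> allocation X \<and>
     (\<forall>i j. \<forall>k\<in>X j. bundle_value v i (X i) \<ge> bundle_value v i (X j - {k}))"

text \<open>The nested maximum over \<open>r \<notin> {i, j}\<close> is merged into the outer one, so that it is omitted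
  when there are only two agents.\<close>

definition inner_max :: "('m \<Rightarrow> 'n \<Rightarrow> real) \<Rightarrow> real ^ 'n::finite ^ 'm::finite \<Rightarrow> 'm \<Rightarrow> 'n \<Rightarrow> 'n \<Rightarrow> real" where
  "inner_max v y l i j =
     Max ({y $ l $ i - v l i, y $ l $ j + v l i} \<union> {y $ l $ r | r. r \<notin> {i, j}})"

definition hbar :: "('m \<Rightarrow> 'n \<Rightarrow> real) \<Rightarrow> real ^ 'n::finite ^ 'm::finite \<Rightarrow> real" where
  "hbar v y = Max {y $ k $ j + (\<Sum>l\<in>UNIV - {k}. inner_max v y l i j) | i j k. i \<noteq> j}"

definition hsum :: "real ^ 'n::finite ^ 'm::finite \<Rightarrow> real" where
  "hsum y = (\<Sum>l\<in>UNIV. MAX r. y $ l $ r)"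

text \<open>The variables are triples \<open>(y, w, z)\<close>. The entries \<open>z $ l $ i $ i\<close> are not variables of the
  program: they occur neither in the constraints nor in the objective.\<close>

type_synonym ('m, 'n) lp_point = "(real ^ 'n ^ 'm) \<times> real \<times> (real ^ 'n ^ 'n ^ 'm)"

definition lp_feasible :: "('m \<Rightarrow> 'n \<Rightarrow> real) \<Rightarrow> ('m::finite, 'n::finite) lp_point set" where
  "lp_feasible v = {(y, w, z).
     (\<forall>k i j. i \<noteq> j \<longrightarrow> y $ k $ j + (\<Sum>l\<in>UNIV - {k}. z $ l $ i $ j) - w \<le> 0) \<and>
     (\<forall>l i j. i \<noteq> j \<longrightarrow> y $ l $ i - z $ l $ i $ j \<le> v l i) \<and>
     (\<forall>l i j. i \<noteq> j \<longrightarrow> y $ l $ j - z $ l $ i $ j \<le> - v l i) \<and>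
     (\<forall>l i j r. i \<noteq> j \<longrightarrow> r \<notin> {i, j} \<longrightarrow> y $ l $ r - z $ l $ i $ j \<le> 0)}"

definition lp_objective :: "('m::finite, 'n::finite) lp_point \<Rightarrow> real" where
  "lp_objective = (\<lambda>(y, w, z). w - hsum y)"

definition piecewise_linear :: "('a::euclidean_space \<Rightarrow> real) \<Rightarrow> bool" where
  "piecewise_linear f \<longleftrightarrow> (\<exists>\<P>. finite \<P> \<and> \<Union>\<P> = UNIV \<and>
     (\<forall>P\<in>\<P>. polyhedron P \<and> (\<exists>a c. \<forall>x\<in>P. f x = a \<bullet> x + c)))"

end

theory Submission
  imports Defs
begin

text \<open>Identify an allocation with its owner map \<open>a\<close>, and let \<open>x\<^sub>a\<close> be its 0/1 indicator vector. Expanding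
  all inner maxima gives \<open>h(y) = max\<^sub>a \<langle>x\<^sub>a, y\<rangle>\<close> and \<open>hbar(y) = max\<^sub>a (\<langle>x\<^sub>a, y\<rangle> + F(a))\<close>, where \<open>F(a)\<close> is
  the largest violation \<open>v\<^sub>i(X\<^sub>j - {k}) - v\<^sub>i(X\<^sub>i)\<close> of the EFX conditions. Hence \<open>hbar - h\<close> is at least
  the minimum of \<open>F\<close>, and since the \<open>x\<^sub>a\<close> are vertices of the cube, that minimum is
  reached at \<open>y = T x\<^sub>a\<close> for a large multiple \<open>T\<close>.\<close>

section \<open>Finite maxima, sums and linear functionals\<close>

lemma convex_on_Max:
  fixes F :: "('a::real_vector \<Rightarrow> real) set"
  assumes "finite F" "F \<noteq> {}" "\<And>f. f \<in> F \<Longrightarrow> convex_on S f" "convex S"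
  shows "convex_on S (\<lambda>x. Max ((\<lambda>f. f x) ` F))"
proof (rule convex_onI)
  fix t :: real and x y
  assume t: "0 < t" "t < 1" and xy: "x \<in> S" "y \<in> S"
  let ?M = "\<lambda>x. Max ((\<lambda>f. f x) ` F)"
  show "?M ((1 - t) *\<^sub>R x + t *\<^sub>R y) \<le> (1 - t) * ?M x + t * ?M y"
  proof (subst Max_le_iff; (intro ballI)?)
    fix b assume "b \<in> (\<lambda>f. f ((1 - t) *\<^sub>R x + t *\<^sub>R y)) ` F"
    then obtain f where f: "f \<in> F" "b = f ((1 - t) *\<^sub>R x + t *\<^sub>R y)" by auto
    have "b \<le> (1 - t) * f x + t * f y"
      using convex_onD[OF assms(3)[OF f(1)], of t x y] t xy f(2) by auto
    also have "\<dots> \<le> (1 - t) * ?M x + t * ?M y"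
      using f(1) assms(1) t by (intro add_mono mult_left_mono Max_ge) auto
    finally show "b \<le> (1 - t) * ?M x + t * ?M y" .
  qed (use assms in auto)
qed (fact assms(4))

lemma continuous_on_Max:
  fixes F :: "('a::topological_space \<Rightarrow> real) set"
  assumes "finite F" "F \<noteq> {}" "\<And>f. f \<in> F \<Longrightarrow> continuous_on S f"
  shows "continuous_on S (\<lambda>x. Max ((\<lambda>f. f x) ` F))"
  using assms
proof (induction F rule: finite_ne_induct)
  case (insert f F)
  then have "continuous_on S (\<lambda>x. max (f x) (Max ((\<lambda>f. f x) ` F)))"
    by (intro continuous_on_max) auto
  then show ?case using insert.hyps by simp
qed simp

lemma convex_on_sum_fun:
  fixes f :: "'i \<Rightarrow> 'a::real_vector \<Rightarrow> real"
  assumes "finite I" "convex S" "\<And>i. i \<in> I \<Longrightarrow> convex_on S (f i)"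
  shows "convex_on S (\<lambda>x. \<Sum>i\<in>I. f i x)"
  using assms by (induction I rule: finite_induct) (auto simp: convex_on_const)

lemma convex_on_linear_functional:
  fixes f :: "'a::real_vector \<Rightarrow> real"
  assumes "linear f"
  shows "convex_on UNIV f"
  by (rule convex_onI) (simp_all add: linear_add[OF assms] linear_scale[OF assms])

lemma linear_entry: "linear (\<lambda>y :: real ^ 'n ^ 'm. y $ l $ r)"
  by (rule linearI) auto

text \<open>The Riesz vector is the adjoint applied to 1. It puts functionals into the inner-product
  form that half-spaces and \<open>piecewise_linear\<close> ask for.\<close>

lemma linear_functional_eq_inner:
  fixes f :: "'a::euclidean_space \<Rightarrow> real"
  assumes "linear f"
  obtains a where "\<And>x. f x = a \<bullet> x"
proof
  show "f x = adjoint f 1 \<bullet> x" for x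
    using adjoint_works[OF assms, of x 1] by (simp add: inner_commute)
qed

section \<open>Continuity and convexity of \<open>hbar\<close> and \<open>hsum\<close>\<close>

lemma inner_max_altdef:
  "inner_max v y l i j = Max ((\<lambda>f. f y) `
     ({\<lambda>y. y $ l $ i - v l i, \<lambda>y. y $ l $ j + v l i} \<union> (\<lambda>r y. y $ l $ r) ` {r. r \<notin> {i, j}}))"
  unfolding inner_max_def image_Un image_image by (intro arg_cong[where f = Max]) auto

text \<open>The \<open>altdef\<close> forms write each maximum as a finite set of functions,
  independent of \<open>y\<close>, evaluated at \<open>y\<close>. This is the shape treated by
  \<open>convex_on_Max\<close> and \<open>continuous_on_Max\<close>.\<close>

lemma hbar_altdef:
  "hbar v y = Max ((\<lambda>f. f y) ` (\<lambda>(i, j, k) y. y $ k $ j +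
     (\<Sum>l\<in>UNIV - {k}. inner_max v y l i j)) ` {(i, j, k). i \<noteq> j})"
  unfolding hbar_def image_image by (intro arg_cong[where f = Max]) (auto simp: image_iff, blast)

lemma hsum_altdef:
  "hsum y = (\<Sum>l\<in>UNIV. Max ((\<lambda>f. f y) ` range (\<lambda>r y. y $ l $ r)))"
  unfolding hsum_def image_image ..

text \<open>Ensures that the \<open>Max\<close> in \<open>hbar\<close> ranges over a nonempty set;
  an item \<open>k\<close> exists because types are inhabited.\<close>

lemma distinct_agents_nonempty:
  assumes "CARD('n::finite) \<ge> 2"
  shows "{(i, j, k). (i :: 'n) \<noteq> j} \<noteq> {}"
proof -
  from assms obtain i j :: 'n where "i \<noteq> j"
    using ex_card[of 2 "UNIV :: 'n set"] by (auto simp: card_2_iff)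
  then show ?thesis by auto
qed

lemma continuous_inner_max: "continuous_on UNIV (\<lambda>y. inner_max v y l i j)"
  unfolding inner_max_altdef
  by (rule continuous_on_Max) (auto intro!: continuous_intros)

lemma convex_inner_max:
  "convex_on UNIV (\<lambda>y :: real ^ 'n::finite ^ 'm::finite. inner_max v y l i j)"
  unfolding inner_max_altdef
proof (rule convex_on_Max)
  \<comment> \<open>All members of the set are an entry plus a constant: \<open>- v l i\<close>,
    \<open>v l i\<close> or 0.\<close>
  have "convex_on UNIV (\<lambda>y :: real ^ 'n ^ 'm. y $ l $ r + c)" for r c
    by (intro convex_on_add convex_on_linear_functional[OF linear_entry])
      (simp add: convex_on_const)
  from this[of i "- v l i"] this[of j "v l i"] this[of _ 0]
  show "convex_on UNIV f" if "f \<in> {\<lambda>y. y $ l $ i - v l i, \<lambda>y. y $ l $ j + v l i}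
      \<union> (\<lambda>r y. y $ l $ r) ` {r. r \<notin> {i, j}}" for f :: "real ^ 'n ^ 'm \<Rightarrow> real"
    using that by auto
qed auto

lemma continuous_hbar:
  assumes "CARD('n::finite) \<ge> 2"
  shows "continuous_on UNIV (hbar v :: real ^ 'n ^ 'm::finite \<Rightarrow> real)"
  unfolding hbar_altdef
  using distinct_agents_nonempty[OF assms]
  by (intro continuous_on_Max) (auto intro!: continuous_intros continuous_inner_max)

lemma convex_hbar:
  assumes "CARD('n::finite) \<ge> 2"
  shows "convex_on UNIV (hbar v :: real ^ 'n ^ 'm::finite \<Rightarrow> real)"
  unfolding hbar_altdef
  using distinct_agents_nonempty[OF assms]
  by (intro convex_on_Max) (auto intro!: convex_on_add convex_on_sum_fun convex_inner_max
    convex_on_linear_functional[OF linear_entry])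

lemma continuous_hsum: "continuous_on UNIV hsum"
  unfolding hsum_altdef
  by (intro continuous_on_sum continuous_on_Max) (auto intro!: continuous_intros)

lemma convex_hsum: "convex_on UNIV hsum"
  unfolding hsum_altdef
  by (intro convex_on_sum_fun convex_on_Max)
    (auto intro!: convex_on_linear_functional[OF linear_entry])

section \<open>Concavity and piecewise linearity of the objective\<close>

lemma concave_lp_objective:
  "concave_on UNIV (lp_objective :: ('m::finite, 'n::finite) lp_point \<Rightarrow> real)"
  unfolding concave_on_def
proof (rule convex_onI)
  fix t :: real and p q :: "('m, 'n) lp_point"
  assume t: "0 < t" "t < 1"
  obtain y w z y' w' z' where pq: "p = (y, w, z)" "q = (y', w', z')"
    by (metis prod_cases3)
  show "- lp_objective ((1 - t) *\<^sub>R p + t *\<^sub>R q) \<le> (1 - t) * - lp_objective p + t * - lp_objective q"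
    \<comment> \<open>\<open>w\<close> enters linearly and \<open>z\<close> not at all, so only the
      convexity inequality of \<open>hsum\<close> remains.\<close>
    using convex_onD[OF convex_hsum, of t y y'] t
    by (simp add: pq lp_objective_def algebra_simps)
qed auto

text \<open>Giving each item to an agent with the largest entry in its row yields an owner map
  attaining \<open>hsum\<close>. Such maps index the linear pieces of the objective and later supply
  the allocation for the lower bound on \<open>hbar\<close>.\<close>

lemma row_maximizer:
  fixes y :: "real ^ 'n::finite ^ 'm::finite"
  obtains a where "\<And>l r. y $ l $ r \<le> y $ l $ a l"
proof -
  have "\<exists>s. \<forall>r. y $ l $ r \<le> y $ l $ s" for l
  proof -
    have "Max (range (\<lambda>r. y $ l $ r)) \<in> range (\<lambda>r. y $ l $ r)" by (rule Max_in) auto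
    then obtain s where "Max (range (\<lambda>r. y $ l $ r)) = y $ l $ s" by blast
    moreover have "y $ l $ r \<le> Max (range (\<lambda>r. y $ l $ r))" for r by (rule Max_ge) auto
    ultimately show ?thesis by metis
  qed
  then show ?thesis using that by metis
qed

text \<open>There is one piece \<open>P a\<close> per owner map: the points where \<open>a l\<close>
  maximizes row \<open>l\<close> for every \<open>l\<close>. It is cut out by finitely many
  half-spaces, and on it \<open>hsum\<close> is the sum of the selected entries, hence linear. The
  pieces cover the space by \<open>row_maximizer\<close>.\<close>

lemma piecewise_linear_lp_objective:
  "piecewise_linear (lp_objective :: ('m::finite, 'n::finite) lp_point \<Rightarrow> real)"
proof -
  define P :: "('m \<Rightarrow> 'n) \<Rightarrow> ('m, 'n) lp_point set"
    where "P = (\<lambda>a. \<Inter>(l, r)\<in>UNIV. {p. fst p $ l $ r - fst p $ l $ a l \<le> 0})"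
  have "polyhedron {p :: ('m, 'n) lp_point. fst p $ l $ r - fst p $ l $ s \<le> 0}" for l r s
  proof -
    have "linear (\<lambda>p :: ('m, 'n) lp_point. fst p $ l $ r - fst p $ l $ s)"
      by (rule linearI) (auto simp: algebra_simps)
    then obtain u where "\<And>p :: ('m, 'n) lp_point. fst p $ l $ r - fst p $ l $ s = u \<bullet> p"
      by (rule linear_functional_eq_inner) blast
    then show ?thesis by (simp add: polyhedron_halfspace_le)
  qed
  then have "polyhedron (P a)" for a
    unfolding P_def by (intro polyhedron_Inter) auto
  moreover have "\<exists>u c. \<forall>p\<in>P a. lp_objective p = u \<bullet> p + c" for a
  proof -
    have "linear (\<lambda>p :: ('m, 'n) lp_point. fst (snd p) - (\<Sum>l\<in>UNIV. fst p $ l $ a l))"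
      by (rule linearI) (auto simp: algebra_simps sum.distrib sum_distrib_left)
    then obtain u where u: "\<And>p :: ('m, 'n) lp_point.
        fst (snd p) - (\<Sum>l\<in>UNIV. fst p $ l $ a l) = u \<bullet> p"
      by (rule linear_functional_eq_inner) blast
    have "lp_objective p = u \<bullet> p + 0" if "p \<in> P a" for p
    proof -
      have "(MAX r. fst p $ l $ r) = fst p $ l $ a l" for l
        using that by (intro Max_eqI) (auto simp: P_def)
      then show ?thesis
        by (simp add: u[symmetric] lp_objective_def hsum_def case_prod_beta)
    qed
    then show ?thesis by blast
  qed
  moreover have "\<Union>(range P) = UNIV"
  proof -
    have "\<exists>a. p \<in> P a" for p :: "('m, 'n) lp_point"
    proof -
      obtain a where "\<And>l r. fst p $ l $ r \<le> fst p $ l $ a l"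
        using row_maximizer[of "fst p"] by blast
      then show ?thesis by (auto simp: P_def)
    qed
    then show ?thesis by auto
  qed
  ultimately show ?thesis
    unfolding piecewise_linear_def by (intro exI[of _ "range P"]) auto
qed

section \<open>Bounds for the maxima and the linear program\<close>

lemma inner_max_ge:
  "y $ l $ i - v l i \<le> inner_max v y l i j"
  "y $ l $ j + v l i \<le> inner_max v y l i j"
  "r \<noteq> i \<Longrightarrow> r \<noteq> j \<Longrightarrow> y $ l $ r \<le> inner_max v y l i j"
  unfolding inner_max_def by (rule Max_ge; auto)+

lemma inner_max_leI:
  assumes "y $ l $ i - v l i \<le> c" "y $ l $ j + v l i \<le> c"
    "\<And>r. r \<noteq> i \<Longrightarrow> r \<noteq> j \<Longrightarrow> y $ l $ r \<le> c"
  shows "inner_max v y l i j \<le> c"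
  unfolding inner_max_def using assms by (subst Max_le_iff) auto

lemma hbar_ge:
  assumes "i \<noteq> j"
  shows "y $ k $ j + (\<Sum>l\<in>UNIV - {k}. inner_max v y l i j) \<le> hbar v y"
  unfolding hbar_altdef using assms by (intro Max_ge) (auto simp: image_iff)

lemma hbar_leI:
  fixes y :: "real ^ 'n::finite ^ 'm::finite"
  assumes "CARD('n) \<ge> 2"
    and "\<And>i j k. i \<noteq> j \<Longrightarrow> y $ k $ j + (\<Sum>l\<in>UNIV - {k}. inner_max v y l i j) \<le> c"
  shows "hbar v y \<le> c"
  unfolding hbar_altdef
  using distinct_agents_nonempty[OF assms(1)] assms(2) by (subst Max_le_iff) auto

text \<open>The last three constraint families say that \<open>z\<close> dominates each candidate of
  the inner maximum, so \<open>z\<close> is an epigraph variable for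
  \<open>inner_max\<close>.\<close>

lemma lp_feasible_iff:
  "(y, w, z) \<in> lp_feasible v \<longleftrightarrow>
     (\<forall>k i j. i \<noteq> j \<longrightarrow> y $ k $ j + (\<Sum>l\<in>UNIV - {k}. z $ l $ i $ j) \<le> w) \<and>
     (\<forall>l i j. i \<noteq> j \<longrightarrow> inner_max v y l i j \<le> z $ l $ i $ j)"
proof -
  have "inner_max v y l i j \<le> z $ l $ i $ j \<longleftrightarrow> y $ l $ i - z $ l $ i $ j \<le> v l i \<and>
      y $ l $ j - z $ l $ i $ j \<le> - v l i \<and>
      (\<forall>r. r \<notin> {i, j} \<longrightarrow> y $ l $ r - z $ l $ i $ j \<le> 0)" for l i j
    unfolding inner_max_def by (subst Max_le_iff) (auto simp: algebra_simps)
  then show ?thesis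
    unfolding lp_feasible_def by auto
qed

text \<open>Feasibility forces \<open>hbar v y \<le> w\<close>; conversely
  \<open>w = hbar v y\<close> with \<open>z\<close> equal to the inner maxima is feasible. Extended
  reals allow the infima to be compared before they are known to be finite.\<close>

lemma INF_hbar_eq_INF_lp:
  fixes v :: "'m::finite \<Rightarrow> 'n::finite \<Rightarrow> real"
  assumes "CARD('n) \<ge> 2"
  shows "(INF y. ereal (hbar v y - hsum y)) = (INF p\<in>lp_feasible v. ereal (lp_objective p))"
proof (rule antisym)
  show "(INF y. ereal (hbar v y - hsum y)) \<le> (INF p\<in>lp_feasible v. ereal (lp_objective p))"
  proof (rule INF_greatest)
    fix p assume p: "p \<in> lp_feasible v"
    obtain y w z where yz: "p = (y, w, z)" by (metis prod_cases3)
    have "hbar v y \<le> w"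
    proof (rule hbar_leI[OF assms])
      fix i j :: 'n and k :: 'm
      assume "i \<noteq> j"
      with p have "(\<Sum>l\<in>UNIV - {k}. inner_max v y l i j) \<le> (\<Sum>l\<in>UNIV - {k}. z $ l $ i $ j)"
        "y $ k $ j + (\<Sum>l\<in>UNIV - {k}. z $ l $ i $ j) \<le> w"
        by (auto simp: yz lp_feasible_iff intro!: sum_mono)
      then show "y $ k $ j + (\<Sum>l\<in>UNIV - {k}. inner_max v y l i j) \<le> w" by linarith
    qed
    then show "(INF y. ereal (hbar v y - hsum y)) \<le> ereal (lp_objective p)"
      by (intro INF_lower2[of y]) (auto simp: yz lp_objective_def)
  qed
  show "(INF p\<in>lp_feasible v. ereal (lp_objective p)) \<le> (INF y. ereal (hbar v y - hsum y))"
  proof (rule INF_greatest)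
    fix y :: "real ^ 'n ^ 'm"
    have "(y, hbar v y, \<chi> l i j. inner_max v y l i j) \<in> lp_feasible v"
      by (auto simp: lp_feasible_iff hbar_ge)
    then show "(INF p\<in>lp_feasible v. ereal (lp_objective p)) \<le> ereal (hbar v y - hsum y)"
      by (rule INF_lower2) (simp add: lp_objective_def)
  qed
qed

section \<open>Owner maps and EFX violations\<close>

lemma allocation_owner:
  assumes "allocation X"
  obtains a where "\<And>i. X i = {k. a k = i}"
proof -
  from assms have "\<forall>k. \<exists>i. k \<in> X i" by (auto simp: allocation_def)
  then obtain a where "\<And>k. k \<in> X (a k)" by metis
  with assms have "X i = {k. a k = i}" for i
    by (auto simp: allocation_def disjoint_family_on_def)
  then show ?thesis using that by blast
qed

text \<open>The envied agent must own \<open>k\<close>, so it is \<open>a k\<close>. The case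
  \<open>i = a k\<close> holds automatically, since removing an item cannot raise a nonnegative
  value.\<close>

lemma EFX_allocation_owner_iff:
  fixes v :: "'m::finite \<Rightarrow> 'n::finite \<Rightarrow> real"
  assumes "\<And>l i. v l i \<ge> 0"
  shows "EFX_allocation v (\<lambda>i. {k. a k = i}) \<longleftrightarrow> (\<forall>i k. i \<noteq> a k \<longrightarrow>
    bundle_value v i ({l. a l = a k} - {k}) \<le> bundle_value v i {l. a l = i})"
proof -
  have "bundle_value v i ({l. a l = i} - {k}) \<le> bundle_value v i {l. a l = i}" for i k
    unfolding bundle_value_def using assms by (intro sum_mono2) auto
  then show ?thesis
    by (auto simp: EFX_allocation_def allocation_def disjoint_family_on_def) metis
qed

text \<open>The summands are the corrections to the entries \<open>y $ l $ a l\<close> inside the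
  inner maxima when the owner of \<open>l\<close> selects the candidate; they add up to the EFX
  violation of \<open>i\<close> towards \<open>j\<close>.\<close>

lemma sum_owner_split:
  fixes v :: "'m::finite \<Rightarrow> 'n::finite \<Rightarrow> real"
  assumes "i \<noteq> j" "a k = j"
  shows "(\<Sum>l\<in>UNIV - {k}. if a l = i then - v l i else if a l = j then v l i else 0) =
    bundle_value v i ({l. a l = j} - {k}) - bundle_value v i {l. a l = i}"
proof -
  have "(\<Sum>l\<in>UNIV - {k}. if a l = i then - v l i else if a l = j then v l i else 0) =
      (\<Sum>l\<in>UNIV - {k}. (if a l = j then v l i else 0) - (if a l = i then v l i else 0))"
    using assms by (intro sum.cong) auto
  also have "\<dots> = (\<Sum>l | l \<noteq> k \<and> a l = j. v l i) - (\<Sum>l | l \<noteq> k \<and> a l = i. v l i)"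
    by (simp add: sum_subtractf sum.If_cases Int_def Compl_eq conj_commute)
  also have "{l. l \<noteq> k \<and> a l = j} = {l. a l = j} - {k}" by auto
  \<comment> \<open>\<open>k\<close> belongs to \<open>j\<close>, so leaving it out does not affect
    the bundle of \<open>i\<close>.\<close>
  also have "{l. l \<noteq> k \<and> a l = i} = {l. a l = i}" using assms by auto
  finally show ?thesis by (simp add: bundle_value_def)
qed

text \<open>The witness is \<open>T\<close> times the indicator of the EFX allocation: terms with
  \<open>k\<close> owned by \<open>j\<close> are controlled by the EFX condition, all others by the
  size of \<open>T\<close>.\<close>

lemma EFX_imp_hbar_le_hsum:
  fixes v :: "'m::finite \<Rightarrow> 'n::finite \<Rightarrow> real"
  assumes n: "CARD('n) \<ge> 2" and v: "\<And>l i. v l i \<ge> 0" and X: "EFX_allocation v X"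
  obtains y where "hbar v y \<le> hsum y"
proof -
  from X obtain a where a: "\<And>i. X i = {k. a k = i}"
    using allocation_owner by (auto simp: EFX_allocation_def)
  with X have "X = (\<lambda>i. {k. a k = i})" by auto
  with X have efx: "bundle_value v i ({l. a l = a k} - {k}) \<le> bundle_value v i {l. a l = i}"
    if "i \<noteq> a k" for i k
    using that EFX_allocation_owner_iff[where v = v and a = a, OF v] by auto
  \<comment> \<open>Half of \<open>T\<close> exceeds or equals both any single value and any agent's
    value of all items. The factor 2 is what gives \<open>v l i \<le> T - v l i\<close> in the
    estimate of \<open>inner_max\<close>.\<close>
  define T where "T = 2 * (\<Sum>i\<in>UNIV. \<Sum>l\<in>UNIV. v l i)"
  have T: "2 * (\<Sum>l\<in>UNIV. v l i) \<le> T" for i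
    unfolding T_def using member_le_sum[of i UNIV "\<lambda>i. \<Sum>l\<in>UNIV. v l i"] v
    by (auto intro: sum_nonneg)
  have vT: "2 * v l i \<le> T" for l i
    using T[of i] member_le_sum[of l UNIV "\<lambda>l. v l i"] v by fastforce
  define y :: "real ^ 'n ^ 'm" where "y = (\<chi> l r. if r = a l then T else 0)"
  have T0: "0 \<le> T" using vT[of undefined undefined] v[of undefined undefined] by linarith
  have hs: "hsum y = real CARD('m) * T"
  proof -
    have "(MAX r. y $ l $ r) = T" for l
      using T0 by (intro Max_eqI) (auto simp: y_def image_iff)
    then show ?thesis by (simp add: hsum_def)
  qed
  have "hbar v y \<le> hsum y"
  proof (rule hbar_leI[OF n])
    fix i j :: 'n and k :: 'm
    assume ij: "i \<noteq> j"
    \<comment> \<open>The candidate containing the owner's entry \<open>T\<close> wins the maximum.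
      The critical case is \<open>a l = i\<close>, where \<open>T - v l i\<close> competes with
      \<open>v l i\<close>.\<close>
    have im: "inner_max v y l i j \<le> T + (if a l = i then - v l i else if a l = j then v l i else 0)" for l
      using ij vT[of l i] v[of l i] by (intro inner_max_leI) (auto simp: y_def)
    have card: "(\<Sum>l\<in>UNIV - {k}. T) = real CARD('m) * T - T"
      by (simp add: card_Diff_singleton of_nat_diff algebra_simps)
    show "y $ k $ j + (\<Sum>l\<in>UNIV - {k}. inner_max v y l i j) \<le> hsum y"
    proof (cases "a k = j")
      case True
      \<comment> \<open>Together with \<open>y $ k $ j = T\<close>, the copies of \<open>T\<close>
        add up to \<open>hsum y\<close>; what is left is an EFX violation, which is
        nonpositive.\<close>
      have "(\<Sum>l\<in>UNIV - {k}. inner_max v y l i j) \<le> (\<Sum>l\<in>UNIV - {k}. T) +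
          (bundle_value v i ({l. a l = j} - {k}) - bundle_value v i {l. a l = i})"
        unfolding sum_owner_split[where v = v and a = a and k = k, OF ij True, symmetric] sum.distrib[symmetric]
        by (intro sum_mono im)
      moreover have "y $ k $ j = T" using True by (simp add: y_def)
      ultimately show ?thesis using efx[of i k] ij True card hs by simp
    next
      case False
      \<comment> \<open>Here \<open>y $ k $ j = 0\<close>, so one whole \<open>T\<close> is missing,
        which outweighs all the corrections \<open>v l i\<close> together.\<close>
      have "inner_max v y l i j \<le> T + v l i" for l
        using im[of l] v[of l i] by (auto split: if_splits)
      then have "(\<Sum>l\<in>UNIV - {k}. inner_max v y l i j) \<le> (\<Sum>l\<in>UNIV - {k}. T) + (\<Sum>l\<in>UNIV - {k}. v l i)"
        unfolding sum.distrib[symmetric] by (intro sum_mono)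
      moreover have "(\<Sum>l\<in>UNIV - {k}. v l i) \<le> (\<Sum>l\<in>UNIV. v l i)"
        using v by (intro sum_mono2) auto
      moreover have "0 \<le> (\<Sum>l\<in>UNIV. v l i)" using v by (intro sum_nonneg)
      moreover have "y $ k $ j = 0" using False by (simp add: y_def)
      ultimately show ?thesis using T[of i] card hs by linarith
    qed
  qed
  then show ?thesis using that by blast
qed

text \<open>With \<open>j = a k\<close>, the entries selected by \<open>a\<close> sum to
  \<open>hsum y\<close>, and the same entries with their corrections are candidates in the maxima of
  \<open>hbar\<close>. The surplus is the violation.\<close>

lemma hbar_diff_hsum_ge:
  fixes v :: "'m::finite \<Rightarrow> 'n::finite \<Rightarrow> real"
  assumes a: "\<And>l r. y $ l $ r \<le> y $ l $ a l" and i: "i \<noteq> a k"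
  shows "bundle_value v i ({l. a l = a k} - {k}) - bundle_value v i {l. a l = i} \<le> hbar v y - hsum y"
proof -
  let ?c = "\<lambda>l. if a l = i then - v l i else if a l = a k then v l i else 0"
  have "(MAX r. y $ l $ r) = y $ l $ a l" for l
    using a by (intro Max_eqI) auto
  then have "hsum y = y $ k $ a k + (\<Sum>l\<in>UNIV - {k}. y $ l $ a l)"
    by (simp add: hsum_def sum.remove[of UNIV k])
  moreover have "(\<Sum>l\<in>UNIV - {k}. y $ l $ a l + ?c l) \<le> (\<Sum>l\<in>UNIV - {k}. inner_max v y l i (a k))"
  proof (rule sum_mono)
    \<comment> \<open>The owner of \<open>l\<close> decides which of the three kinds of candidate is
      used: \<open>i\<close>, \<open>a k\<close>, or another agent.\<close>
    show "y $ l $ a l + ?c l \<le> inner_max v y l i (a k)" for l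
      using inner_max_ge[where y = y and l = l and i = i and j = "a k" and v = v]
      by (cases "a l = i"; cases "a l = a k") auto
  qed
  ultimately show ?thesis
    using hbar_ge[where y = y and k = k and v = v, OF i] sum_owner_split[where v = v and a = a and k = k, OF i refl]
    by (simp add: sum.distrib)
qed

text \<open>Positivity at each \<open>y\<close> would not bound the infimum away from 0. Finiteness
  does: there are finitely many owner maps, agents and items, so the positive violations have a
  positive minimum, a bound uniform in \<open>y\<close>.\<close>

lemma no_EFX_imp_INF_pos:
  fixes v :: "'m::finite \<Rightarrow> 'n::finite \<Rightarrow> real"
  assumes v: "\<And>l i. v l i \<ge> 0" and no: "\<nexists>X. EFX_allocation v X"
  shows "(INF y. ereal (hbar v y - hsum y)) > 0"
proof -
  define d where "d = (\<lambda>(a :: 'm \<Rightarrow> 'n, i, k).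
    bundle_value v i ({l. a l = a k} - {k}) - bundle_value v i {l. a l = i})"
  define D where "D = {d (a, i, k) | a i k. d (a, i, k) > 0}"
  \<comment> \<open>Every owner map describes an allocation, so each one violates some EFX
    condition.\<close>
  have ex: "\<exists>i k. i \<noteq> a k \<and> d (a, i, k) > 0" for a
    using no EFX_allocation_owner_iff[where v = v and a = a, OF v] by (force simp: d_def not_le)
  have "D \<subseteq> range d" by (auto simp: D_def)
  then have fin: "finite D" by (rule finite_subset) simp
  have "D \<noteq> {}" using ex by (fastforce simp: D_def)
  with fin have "Min D \<in> D" by (rule Min_in)
  then have pos: "0 < Min D" by (auto simp: D_def)
  have "ereal (Min D) \<le> (INF y. ereal (hbar v y - hsum y))"
  proof (rule INF_greatest)
    fix y :: "real ^ 'n ^ 'm"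
    obtain a where a: "\<And>l r. y $ l $ r \<le> y $ l $ a l"
      using row_maximizer[of y] by blast
    from ex obtain i k where ik: "i \<noteq> a k" "d (a, i, k) > 0" by blast
    then have "Min D \<le> d (a, i, k)" using fin by (auto simp: D_def intro!: Min_le)
    with hbar_diff_hsum_ge[where v = v, OF a ik(1)]
    show "ereal (Min D) \<le> ereal (hbar v y - hsum y)" by (simp add: d_def)
  qed
  moreover from pos have "0 < ereal (Min D)" by simp
  ultimately show ?thesis by (rule less_le_trans[rotated])
qed

theorem mainTheorem4:
  fixes v :: "'m::finite \<Rightarrow> 'n::finite \<Rightarrow> real"
  assumes "CARD('n) \<ge> 2"
    and "\<And>l i. v l i \<ge> 0"
  shows "continuous_on UNIV (hbar v) \<and> convex_on UNIV (hbar v)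
    \<and> continuous_on UNIV (hsum :: real ^ 'n ^ 'm \<Rightarrow> real)
    \<and> convex_on UNIV (hsum :: real ^ 'n ^ 'm \<Rightarrow> real)
    \<and> piecewise_linear (lp_objective :: ('m, 'n) lp_point \<Rightarrow> real)
    \<and> concave_on UNIV (lp_objective :: ('m, 'n) lp_point \<Rightarrow> real)
    \<and> (INF y. ereal (hbar v y - hsum y)) = (INF p\<in>lp_feasible v. ereal (lp_objective p))
    \<and> ((\<exists>X. EFX_allocation v X) \<longleftrightarrow> (INF y. ereal (hbar v y - hsum y)) \<le> 0)"
proof (intro conjI iffI)
  assume "\<exists>X. EFX_allocation v X"
  then obtain y where "hbar v y \<le> hsum y"
    using EFX_imp_hbar_le_hsum[where v = v, OF assms] by blast
  then show "(INF y. ereal (hbar v y - hsum y)) \<le> 0"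
    by (intro INF_lower2[of y]) auto
next
  assume "(INF y. ereal (hbar v y - hsum y)) \<le> 0"
  then show "\<exists>X. EFX_allocation v X"
    using no_EFX_imp_INF_pos[where v = v, OF assms(2)] by (meson not_le)
qed (use assms(1) in \<open>auto intro: continuous_hbar convex_hbar continuous_hsum convex_hsum
    piecewise_linear_lp_objective concave_lp_objective INF_hbar_eq_INF_lp\<close>)

end
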